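(* Let $M\in\mathbf{M}_{AD}(V)$ be an AD-model respecting the background $V$ and let $e$ be a $V$-regular event. If $M$ is conditionable on $e$, i.e. if $0\notin M_{\mathrm{acc}}\Vert e+V_{\mathrm{des}}$, then the $V$-natural extension $M\vert e:=\mathrm{cl}_{\mathbf M}\big(\langle M_{\mathrm{acc}}\Vert e\,;\,-(M_{\mathrm{des}}\Vert e)\rangle\cup V\big)$ of the AD-assessment $\langle M_{\mathrm{acc}}\Vert e\,;\,-(M_{\mathrm{des}}\Vert e)\rangle$ is the AD-model in $\mathbf{M}_{AD}(V)$ given by $$M\vert e=\big\langle M_{\mathrm{acc}}\Vert e\,;\,-\big(M_{\mathrm{des}}\Vert e\,\cup\,(V_{\mathrm{des}}+M_{\mathrm{acc}}\Vert e)\big)\big\rangle .$$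
   Context: Options: $\mathscr U$ is a real linear space with $\mathscr U\neq\{0\}$. For $A,B\subseteq\mathscr U$: $-A=\{-u:u\in A\}$, $A+B=\{u+v:u\in A,v\in B\}$, $A-B=A+(-B)$; $\mathrm{posi}(B)$ is the set of all finite (non-empty) linear combinations of elements of $B$ with strictly positive coefficients; $\mathrm{sh}(B)=\{\lambda u:u\in B,\lambda>0\}$. A convex cone is a set closed under addition and under multiplication by strictly positive reals (the empty set qualifies). Assessments: an assessment is a pair $A=\langle A_{\mathrm{acc}};A_{\mathrm{rej}}\rangle$ of subsets of $\mathscr U$ (accepted and rejected options); inclusion, union and intersection of assessments are componentwise. Its set of desirable options is $A_{\mathrm{des}}=A_{\mathrm{acc}}\cap(-A_{\mathrm{rej}})$. An AD-assessment is an assessment with $A_{\mathrm{rej}}\subseteq-A_{\mathrm{acc}}$ (equivalently $A=\langle A_{\mathrm{acc}};-A_{\mathrm{des}}\rangle$). A statement model is an assessment $M$ with (M1) $0\in M_{\mathrm{acc}}$; (M2) $0\notin M_{\mathrm{rej}}$; (M3) $M_{\mathrm{acc}}$ is a convex cone; (M4) $\mathrm{sh}(M_{\mathrm{rej}})-M_{\mathrm{acc}}\subseteq M_{\mathrm{rej}}$. $\mathbf M$ is the set of all statement models. An AD-model is a statement model that is an AD-assessment. $\mathbf{M}_{AD}(V)$ is the set of AD-models $M$ with $V\subseteq M$. For an assessment $A$, $\mathrm{cl}_{\mathbf M}(A)$ is the intersection of all statement models including $A$, and equals $\langle\mathscr U;\mathscr U\rangle$ if there are none. Background: $V=\langle V_{\mathrm{acc}};-V_{\mathrm{des}}\rangle$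 is a fixed AD-model. Write $u\geq v$ iff $u-v\in V_{\mathrm{acc}}$; $u\gtrdot v$ iff $u-v\in V_{\mathrm{des}}$; $u>v$ iff $u\ge v$ and $u\ne v$. Assume there is a unit option $\mathbf 1\in V_{\mathrm{des}}$ such that for every $u\in\mathscr U$ there is a real $\lambda>0$ with $\lambda\mathbf 1\gtrdot u\gtrdot-\lambda\mathbf 1$, and such that $u\gtrdot0$ implies $u\ge\alpha\mathbf 1$ for some real $\alpha>0$. Events: $\mathscr E$ is a non-empty set of events with a calling-off operation $\ast:\mathscr E\times\mathscr U\to\mathscr U$, and kernels $I_e=\{u\in\mathscr U:e\ast u=0\}$, satisfying: (E1) $u\mapsto e\ast u$ is linear; (E2) $e\ast(e\ast u)=e\ast u$; (E3) $u\geq0\Rightarrow e\ast u\geq0$; (E4) there is a unit event $1_{\mathscr E}$ with $1_{\mathscr E}\ast u=u$ for all $u$; (E5) there is a null event $0_{\mathscr E}$ with $0_{\mathscr E}\ast u=0$ for all $u$; (E6) if for all $u$, $e_1\ast u>0\Rightarrow e_2\ast u\neq0$, then $e_1\sqsubseteq e_2$, where $e_1\sqsubseteq e_2$ means $e_1\ast u=e_1\ast(e_2\ast u)=e_2\ast(e_1\ast u)$ for all $u$ (and $\sqsubseteq$ is a partial order, i.e. events with the same calling-off operation are identified); (E7) $\mathbf 1\geq e\ast\mathbf 1$; (E8) for all $e_1,e_2$ there is an event $e_1\sqcap e_2$ with $I_{e_1}+I_{e_2}=I_{e_1\sqcap e_2}$. An event $e$ is $V$-regular if $V_{\mathrm{des}}\cap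 I_e=\emptyset$ (equivalently $0\notin V_{\mathrm{des}}+I_e$). For $W\subseteq\mathscr U$, $W\Vert e:=\{u\in\mathscr U:e\ast u\in W\}$. *)

theory Defs
  imports Complex_Main "HOL-Library.Product_Order" "HOL-Library.Set_Algebras"
begin

text \<open>
  On sets, unary and binary minus are complement and difference in the library, so the
  pointwise negative of \<open>A\<close> is written \<open>neg A\<close>. The sum \<open>A + B\<close> of sets is the pointwise sum
  from \<open>Set_Algebras\<close>.
\<close>

definition neg :: "'u::real_vector set \<Rightarrow> 'u set" where
  "neg A = uminus ` A"

definition sh :: "'u::real_vector set \<Rightarrow> 'u set" where
  "sh B = {l *\<^sub>R u | l u. u \<in> B \<and> l > 0}"

text \<open>
  Unlike the library's \<open>convex_cone\<close>, a blunt cone need not contain 0 and may be empty.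
\<close>

definition blunt_convex_cone :: "'u::real_vector set \<Rightarrow> bool" where
  "blunt_convex_cone C \<longleftrightarrow>
     (\<forall>u\<in>C. \<forall>v\<in>C. u + v \<in> C) \<and> (\<forall>u\<in>C. \<forall>l>0. l *\<^sub>R u \<in> C)"

text \<open>
  An assessment is the pair of its accepted and its rejected options. The order and the lattice
  operations on pairs are componentwise (\<open>Product_Order\<close>): \<open>A \<le> B\<close> is inclusion, \<open>sup A B\<close> is
  union, and \<open>Inf\<close> is intersection.
\<close>

type_synonym 'u assessment = "'u set \<times> 'u set"

abbreviation acc :: "'u assessment \<Rightarrow> 'u set" where "acc A \<equiv> fst A"
abbreviation rej :: "'u assessment \<Rightarrow> 'u set" where "rej A \<equiv> snd A"

definition des :: "'u::real_vector assessment \<Rightarrow> 'u set" where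
  "des A = acc A \<inter> neg (rej A)"

definition AD_assessment :: "'u::real_vector assessment \<Rightarrow> bool" where
  "AD_assessment A \<longleftrightarrow> rej A \<subseteq> neg (acc A)"

definition statement_model :: "'u::real_vector assessment \<Rightarrow> bool" where
  "statement_model M \<longleftrightarrow>
     0 \<in> acc M \<and>
     0 \<notin> rej M \<and>
     blunt_convex_cone (acc M) \<and>
     sh (rej M) + neg (acc M) \<subseteq> rej M"

definition AD_model :: "'u::real_vector assessment \<Rightarrow> bool" where
  "AD_model M \<longleftrightarrow> statement_model M \<and> AD_assessment M"

definition AD_models :: "'u::real_vector assessment \<Rightarrow> 'u assessment set" where
  "AD_models V = {M. AD_model M \<and> V \<le> M}"

text \<open>If no statement model includes \<open>A\<close>, this is \<open>Inf {} = (UNIV, UNIV)\<close>.\<close>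

definition model_closure :: "'u::real_vector assessment \<Rightarrow> 'u assessment" where
  "model_closure A = Inf {M. statement_model M \<and> A \<le> M}"

definition natural_extension ::
    "'u::real_vector assessment \<Rightarrow> 'u assessment \<Rightarrow> 'u assessment" where
  "natural_extension V A = model_closure (sup A V)"

definition weakly_pref :: "'u::real_vector assessment \<Rightarrow> 'u \<Rightarrow> 'u \<Rightarrow> bool" where
  "weakly_pref V u v \<longleftrightarrow> u - v \<in> acc V"

definition des_pref :: "'u::real_vector assessment \<Rightarrow> 'u \<Rightarrow> 'u \<Rightarrow> bool" where
  "des_pref V u v \<longleftrightarrow> u - v \<in> des V"

definition strictly_pref :: "'u::real_vector assessment \<Rightarrow> 'u \<Rightarrow> 'u \<Rightarrow> bool" where
  "strictly_pref V u v \<longleftrightarrow> weakly_pref V u v \<and> u \<noteq> v"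

locale background =
  fixes V :: "'u::real_vector assessment" and unit_opt :: 'u
  assumes nontrivial: "\<exists>u::'u. u \<noteq> 0"
    and AD_model_V: "AD_model V"
    and unit_des: "unit_opt \<in> des V"
    and unit_bounds:
      "\<exists>l>0. des_pref V (l *\<^sub>R unit_opt) u \<and> des_pref V u (- (l *\<^sub>R unit_opt))"
    and unit_below: "des_pref V u 0 \<Longrightarrow> \<exists>a>0. weakly_pref V u (a *\<^sub>R unit_opt)"

definition event_kernel :: "('e \<Rightarrow> 'u::real_vector \<Rightarrow> 'u) \<Rightarrow> 'e \<Rightarrow> 'u set" where
  "event_kernel co e = {u. co e u = 0}"

definition event_below :: "('e \<Rightarrow> 'u::real_vector \<Rightarrow> 'u) \<Rightarrow> 'e \<Rightarrow> 'e \<Rightarrow> bool" where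
  "event_below co e1 e2 \<longleftrightarrow>
     (\<forall>u. co e1 u = co e1 (co e2 u) \<and> co e1 u = co e2 (co e1 u))"

text \<open>Here \<open>co e u\<close> is the option \<open>u\<close> called off unless the event \<open>e\<close> occurs.\<close>

locale event_system = background V unit_opt
  for V :: "'u::real_vector assessment" and unit_opt :: 'u +
  fixes E :: "'e set" and co :: "'e \<Rightarrow> 'u \<Rightarrow> 'u"
  assumes events_nonempty: "E \<noteq> {}"
    and E1: "e \<in> E \<Longrightarrow> linear (co e)"
    and E2: "e \<in> E \<Longrightarrow> co e (co e u) = co e u"
    and E3: "e \<in> E \<Longrightarrow> weakly_pref V u 0 \<Longrightarrow> weakly_pref V (co e u) 0"
    and E4: "\<exists>e1\<in>E. \<forall>u. co e1 u = u"
    and E5: "\<exists>e0\<in>E. \<forall>u. co e0 u = 0"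
    and E6: "e1 \<in> E \<Longrightarrow> e2 \<in> E \<Longrightarrow>
      (\<forall>u. strictly_pref V (co e1 u) 0 \<longrightarrow> co e2 u \<noteq> 0) \<Longrightarrow> event_below co e1 e2"
    and event_below_order:
      "partial_order_on E {(e1, e2). e1 \<in> E \<and> e2 \<in> E \<and> event_below co e1 e2}"
    and E7: "e \<in> E \<Longrightarrow> weakly_pref V unit_opt (co e unit_opt)"
    and E8: "e1 \<in> E \<Longrightarrow> e2 \<in> E \<Longrightarrow>
      \<exists>e\<in>E. event_kernel co e1 + event_kernel co e2 = event_kernel co e"

definition regular_event ::
    "'u::real_vector assessment \<Rightarrow> ('e \<Rightarrow> 'u \<Rightarrow> 'u) \<Rightarrow> 'e \<Rightarrow> bool" where
  "regular_event V co e \<longleftrightarrow> des V \<inter> event_kernel co e = {}"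

definition conditioned :: "('e \<Rightarrow> 'u::real_vector \<Rightarrow> 'u) \<Rightarrow> 'u set \<Rightarrow> 'e \<Rightarrow> 'u set" where
  "conditioned co W e = {u. co e u \<in> W}"

definition conditionable ::
    "'u::real_vector assessment \<Rightarrow> ('e \<Rightarrow> 'u \<Rightarrow> 'u) \<Rightarrow> 'u assessment \<Rightarrow> 'e \<Rightarrow> bool" where
  "conditionable V co M e \<longleftrightarrow> 0 \<notin> conditioned co (acc M) e + des V"

definition conditioned_assessment ::
    "('e \<Rightarrow> 'u::real_vector \<Rightarrow> 'u) \<Rightarrow> 'u assessment \<Rightarrow> 'e \<Rightarrow> 'u assessment" where
  "conditioned_assessment co M e =
     (conditioned co (acc M) e, neg (conditioned co (des M) e))"

definition conditional_model ::
    "'u::real_vector assessment \<Rightarrow> ('e \<Rightarrow> 'u \<Rightarrow> 'u) \<Rightarrow> 'u assessment \<Rightarrow> 'e \<Rightarrow> 'u assessment" where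
  "conditional_model V co M e = natural_extension V (conditioned_assessment co M e)"

end

theory Submission
  imports Defs
begin

text \<open>
  By (E3) every option accepted by the background is accepted conditionally on \<open>e\<close>. Adding the
  background to the conditioned assessment therefore leaves the accepted options unchanged, and
  rejects only what (M4) forces. The result can violate only (M2), which is what conditionability
  excludes.
\<close>

lemma mem_neg [simp]: "x \<in> neg A \<longleftrightarrow> - x \<in> A"
  unfolding neg_def by (metis imageE image_eqI minus_minus)

lemma mem_neg_set_plus: "x \<in> A + neg B \<longleftrightarrow> (\<exists>a\<in>A. \<exists>b\<in>B. x = a - b)"
proof
  assume "x \<in> A + neg B"
  then obtain a b where "a \<in> A" "b \<in> neg B" "x = a + b"
    by (auto elim: set_plus_elim)
  then show "\<exists>a\<in>A. \<exists>b\<in>B. x = a - b"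
    by (metis diff_minus_eq_add mem_neg)
next
  assume "\<exists>a\<in>A. \<exists>b\<in>B. x = a - b"
  then obtain a b where "a \<in> A" "b \<in> B" "x = a + - b"
    by auto
  then show "x \<in> A + neg B"
    by (simp only: set_plus_intro mem_neg minus_minus)
qed

lemma mem_des: "u \<in> des A \<longleftrightarrow> u \<in> acc A \<and> - u \<in> rej A"
  by (simp add: des_def)

lemma statement_model_rej:
  assumes "statement_model M" "r \<in> rej M" "l > 0" "u \<in> acc M"
  shows "l *\<^sub>R r - u \<in> rej M"
proof -
  have "l *\<^sub>R r \<in> sh (rej M)"
    using assms by (auto simp: sh_def)
  then have "l *\<^sub>R r - u \<in> sh (rej M) + neg (acc M)"
    using assms by (auto simp: mem_neg_set_plus)
  then show ?thesis
    using assms by (auto simp: statement_model_def)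
qed

text \<open>(M4) seen through negation: the negative of the claimed option is
  \<open>l *\<^sub>R (- d) - u\<close>, which (M4) rejects, while the cone property gives
  acceptance.\<close>

lemma statement_model_des:
  assumes "statement_model M" "d \<in> des M" "l > 0" "u \<in> acc M"
  shows "l *\<^sub>R d + u \<in> des M"
proof -
  have "l *\<^sub>R (- d) - u \<in> rej M"
    using assms by (intro statement_model_rej) (auto simp: mem_des)
  moreover have "l *\<^sub>R d + u \<in> acc M"
    using assms by (auto simp: mem_des statement_model_def blunt_convex_cone_def)
  ultimately show ?thesis
    by (simp add: mem_des)
qed

lemma statement_model_zero_notin_des:
  "statement_model M \<Longrightarrow> 0 \<notin> des M"
  by (simp add: statement_model_def mem_des)

text \<open>A rejected option of an AD-assessment has an accepted negative, and that negative is
  then desirable.\<close>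

lemma AD_assessment_rej: "AD_assessment A \<Longrightarrow> rej A = neg (des A)"
  by (auto simp: AD_assessment_def mem_des)

text \<open>The infimum is attained at \<open>N\<close> itself, so the default
  \<open>(UNIV, UNIV)\<close> for an assessment without models does not arise.\<close>

lemma model_closure_eqI:
  assumes "statement_model N" "A \<le> N" "\<And>M. statement_model M \<Longrightarrow> A \<le> M \<Longrightarrow> N \<le> M"
  shows "model_closure A = N"
  unfolding model_closure_def by (rule Inf_eqI) (use assms in auto)

text \<open>Events are abstracted away: \<open>C\<close> and \<open>D\<close> stand for the
  conditioned accepted and desirable options, and \<open>consistent\<close> is the form that
  conditionability takes.\<close>

lemma natural_extension_AD:
  fixes V :: "'u::real_vector assessment"
  assumes V: "AD_model V" "acc V \<subseteq> C"
    and C: "blunt_convex_cone C"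
    and D: "D \<subseteq> C" "0 \<notin> D" "\<And>d c l. d \<in> D \<Longrightarrow> c \<in> C \<Longrightarrow> l > 0 \<Longrightarrow> l *\<^sub>R d + c \<in> D"
    and consistent: "0 \<notin> C + des V"
  defines "N \<equiv> (C, neg (D \<union> (des V + C)))"
  shows "natural_extension V (C, neg D) = N" and "N \<in> AD_models V"
proof -
  have SV: "statement_model V"
    using V by (simp add: AD_model_def)
  have zero: "0 \<in> C"
    using SV V by (auto simp: statement_model_def)
  have des_V: "des V \<subseteq> C"
    using V by (auto simp: mem_des)
  have rej_V: "rej V = neg (des V)"
    using V by (simp add: AD_model_def AD_assessment_rej)
  \<comment> \<open>This is (M4) for \<open>N\<close> written in terms of \<open>w = - r\<close>
    with \<open>r\<close> rejected. In the second case the cone \<open>C\<close> absorbs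
    \<open>c\<close>.\<close>
  have cone: "l *\<^sub>R w + c \<in> D \<union> (des V + C)"
    if "w \<in> D \<union> (des V + C)" "l > 0" "c \<in> C" for w c l
    using that(1)
  proof
    assume "w \<in> D"
    then show ?thesis using D that by blast
  next
    assume "w \<in> des V + C"
    then obtain v c' where w: "v \<in> des V" "c' \<in> C" "w = v + c'"
      by (auto elim: set_plus_elim)
    have "l *\<^sub>R v \<in> des V"
      using statement_model_des[OF SV w(1) that(2), of 0] SV by (simp add: statement_model_def)
    moreover have "l *\<^sub>R c' + c \<in> C"
      using C w that by (auto simp: blunt_convex_cone_def)
    ultimately have "l *\<^sub>R v + (l *\<^sub>R c' + c) \<in> des V + C"
      by (rule set_plus_intro)
    then show ?thesis
      by (simp add: w scaleR_add_right add.assoc)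
  qed
  have "sh (rej N) + neg (acc N) \<subseteq> rej N"
  proof
    fix x assume "x \<in> sh (rej N) + neg (acc N)"
    then obtain l r c where x: "r \<in> rej N" "l > 0" "c \<in> C" "x = l *\<^sub>R r - c"
      by (auto simp: mem_neg_set_plus sh_def N_def)
    then have "l *\<^sub>R (- r) + c \<in> D \<union> (des V + C)"
      by (intro cone) (auto simp: N_def)
    then show "x \<in> rej N"
      using x by (simp add: N_def)
  qed
  \<comment> \<open>For (M2), rejecting 0 would put 0 into \<open>D\<close> or into
    \<open>des V + C\<close>; the assumption on \<open>D\<close> excludes the first,
    \<open>consistent\<close> the second.\<close>
  then have SN: "statement_model N"
    using zero C D consistent
    by (auto simp: statement_model_def N_def add.commute)
  have "des V + C \<subseteq> C"
    using des_V C by (auto elim!: set_plus_elim simp: blunt_convex_cone_def)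
  then have "AD_assessment N"
    using D by (auto simp: AD_assessment_def N_def)
  \<comment> \<open>Choosing 0 as the summand from \<open>C\<close> shows that \<open>N\<close>
    rejects whatever \<open>V\<close> rejects.\<close>
  moreover have "des V \<subseteq> des V + C"
    using set_plus_intro[OF _ zero, of _ "des V"] by auto
  then have VN: "V \<le> N"
    using V rej_V by (auto simp: less_eq_prod_def N_def)
  ultimately show "N \<in> AD_models V"
    using SN by (simp add: AD_models_def AD_model_def)
  show "natural_extension V (C, neg D) = N"
    unfolding natural_extension_def
  proof (rule model_closure_eqI[OF SN])
    show "sup (C, neg D) V \<le> N"
      using VN by (auto simp: less_eq_prod_def N_def)
  next
    fix M :: "'u assessment" assume M: "statement_model M" "sup (C, neg D) V \<le> M"
    then have sub: "C \<subseteq> acc M" "neg D \<subseteq> rej M" "rej V \<subseteq> rej M"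
      by (auto simp: less_eq_prod_def)
    \<comment> \<open>Minimality: \<open>M\<close> rejects \<open>- v\<close> because it includes
      \<open>V\<close>, and it accepts \<open>c\<close>, so (M4) with scaling factor 1 forces it to
      reject \<open>- v - c\<close>.\<close>
    have "x \<in> rej M" if x: "- x \<in> des V + C" for x
    proof -
      obtain v c where vc: "v \<in> des V" "c \<in> C" "- x = v + c"
        using x by (blast elim: set_plus_elim)
      then have "1 *\<^sub>R (- v) - c \<in> rej M"
        using sub by (intro statement_model_rej[OF M(1)]) (auto simp: mem_des)
      moreover have "x = - v - c"
        using vc(3) by (metis minus_add_distrib minus_minus uminus_add_conv_diff add.commute)
      ultimately show ?thesis by simp
    qed
    then show "N \<le> M"
      using sub by (auto simp: less_eq_prod_def N_def subset_iff)
  qed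
qed

theorem proposition6:
  fixes V M :: "'u::real_vector assessment" and unit_opt :: 'u
    and E :: "'e set" and co :: "'e \<Rightarrow> 'u \<Rightarrow> 'u" and e :: 'e
  assumes "event_system V unit_opt E co"
    and "M \<in> AD_models V"
    and "e \<in> E"
    and "regular_event V co e"
    and "conditionable V co M e"
  shows "AD_assessment (conditioned_assessment co M e) \<and>
    conditional_model V co M e \<in> AD_models V \<and>
    conditional_model V co M e =
      (conditioned co (acc M) e,
       neg (conditioned co (des M) e \<union> (des V + conditioned co (acc M) e)))"
proof -
  interpret event_system V unit_opt E co by fact
  let ?C = "conditioned co (acc M) e" and ?D = "conditioned co (des M) e"
  have lin: "linear (co e)"
    using E1 assms(3) .
  have SM: "statement_model M" and VM: "acc V \<subseteq> acc M"
    using assms(2) by (auto simp: AD_models_def AD_model_def less_eq_prod_def)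
  \<comment> \<open>By (E3), \<open>co e\<close> maps \<open>acc V\<close> into itself, hence into
    \<open>acc M\<close>.\<close>
  have "acc V \<subseteq> ?C"
    using E3[OF assms(3)] VM by (auto simp: weakly_pref_def conditioned_def)
  moreover have "blunt_convex_cone ?C"
    using SM by (simp add: statement_model_def blunt_convex_cone_def conditioned_def
        linear_add[OF lin] linear_scale[OF lin])
  moreover have "?D \<subseteq> ?C"
    by (auto simp: conditioned_def mem_des)
  moreover have "0 \<notin> ?D"
    using statement_model_zero_notin_des[OF SM] by (simp add: conditioned_def linear_0[OF lin])
  \<comment> \<open>Linearity turns \<open>co e (l *\<^sub>R d + c)\<close> into
    \<open>l *\<^sub>R co e d + co e c\<close>, so the closure property of \<open>des M\<close>
    pulls back along \<open>co e\<close>.\<close>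
  moreover have "l *\<^sub>R d + c \<in> ?D" if "d \<in> ?D" "c \<in> ?C" "l > 0" for d c l
    using statement_model_des[OF SM] that
    by (simp add: conditioned_def linear_add[OF lin] linear_scale[OF lin])
  moreover have "0 \<notin> ?C + des V"
    using assms(5) by (simp add: conditionable_def)
  ultimately have "natural_extension V (?C, neg ?D) = (?C, neg (?D \<union> (des V + ?C)))"
    and "(?C, neg (?D \<union> (des V + ?C))) \<in> AD_models V"
    using natural_extension_AD[OF AD_model_V, of ?C ?D] by blast+
  moreover have "AD_assessment (conditioned_assessment co M e)"
    using \<open>?D \<subseteq> ?C\<close> by (auto simp: AD_assessment_def conditioned_assessment_def)
  ultimately show ?thesis
    by (simp add: conditional_model_def conditioned_assessment_def)
qed

end
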